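(* Consider a stochastic depletion problem with deterministic (known) statistics $P_t(A)$, optimal value function $J^*$ and a myopic policy $\pi^g$. Assume that $J^*$ satisfies the following two properties. (Value Function Monotonicity) For all states $s,s'\in\mathcal S$ with $x(s)\ge x(s')$ and $t(s)=t(s')$, one has $J^*(s)\ge J^*(s')$. (Immediate Rewards) For all $\bar s\in\mathcal S$ and all $\alpha\in\prod_{m=1}^M\{0,1,\dots,x(\bar s)_m\}$, $$J^*(\bar s)\le g\big(x(\bar s),x(\bar s)-\alpha,t(\bar s)\big)+J^*\big(\tilde S_\alpha(\bar s)\big).$$ Then for all $s\in\mathcal S$, $$J^*(s)\le 2\,J^{\pi^g}(s).$$
   Context: Stochastic depletion problem (clairvoyant form). There are $M$ item types, with at most $\bar x_m\in\mathbb Z_+$ items of type $m$; a finite nonempty set $\mathcal A$ of activities; and a horizon $T$ (a positive integer). For each $A\in\mathcal A$ there is a fixed known sequence $P_t(A)$, $t=0,1,2,\dots$, with values in a compact set $\mathcal R$. The state space is $\mathcal S=\{(x,t): x\in\prod_{m}\{0,1,\dots,\bar x_m\},\ t\in\{0,1,\dots,T\}\}$; for $s=(x,t)$ write $x(s)=x$, $t(s)=t$. Vector inequalities are componentwise. If activity $A$ is used in state $s=(x,t)$ with $t<T$, a random vector $X_t$ with values in $\prod_m\{0,\dots,x_m\}$ of items is depleted; its law is determined by $x$ and the sufficient statistic $P_t(A)$, and given these it is independent of the past. The next state is $(x-X_t,t+1)$ and the reward earned is $R(s,A)=g(x,x-X_t,t)$, where $g:\mathbb Z_+^M\times\mathbb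 Z_+^M\times\{0,\dots,T\}\to\mathbb R_+$ is non-negative, $g(x,x',\cdot)$ is non-increasing in time for all $x,x'$, and $g(x,x',T)=0$ for all $x,x'$. A policy is a map $\pi:\mathcal S\to\mathcal A$. Its reward-to-go is $J^\pi(s)=E\big[\sum_{t'=t(s)}^{T-1}R(S_{t'},\pi(S_{t'}))\mid S_{t(s)}=s\big]$, where $S_t$ is the state at time $t$ under $\pi$, and $J^*(s)=\max_\pi J^\pi(s)$. A myopic policy $\pi^g$ is any policy with $\pi^g(s)\in\arg\max_{A\in\mathcal A}E[R(s,A)]$ for every $s$. For $\alpha\in\mathbb Z_+^M$, $\tilde S_\alpha(s)$ is the state $s'$ with $t(s')=t(s)$ and $x(s')_m=\max(x(s)_m-\alpha_m,0)$ for all $m$. *)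

theory Defs
  imports "HOL-Probability.Probability"
begin

text \<open>Item vectors are functions from a finite type of item types to \<^typ>\<open>nat\<close>;
  \<open>\<le>\<close> and \<open>-\<close> on them are pointwise, and subtraction truncates at zero.\<close>

type_synonym 'm state = "('m \<Rightarrow> nat) \<times> nat"

text \<open>\<open>depletion Q x p\<close> is the law of the depleted items when the inventory is \<open>x\<close> and the
  sufficient statistic of the chosen activity is \<open>p\<close>.\<close>

record ('m, 'a, 'r) depletion_data =
  capacity :: "'m \<Rightarrow> nat"
  activities :: "'a set"
  horizon :: nat
  statistic_space :: "'r set"
  statistic :: "nat \<Rightarrow> 'a \<Rightarrow> 'r"
  depletion :: "('m \<Rightarrow> nat) \<Rightarrow> 'r \<Rightarrow> ('m \<Rightarrow> nat) pmf"
  gain :: "('m \<Rightarrow> nat) \<Rightarrow> ('m \<Rightarrow> nat) \<Rightarrow> nat \<Rightarrow> real"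

definition states :: "('m, 'a, 'r) depletion_data \<Rightarrow> 'm state set" where
  "states Q = {x. x \<le> capacity Q} \<times> {..horizon Q}"

locale stochastic_depletion_problem =
  fixes Q :: "('m::finite, 'a, 'r::topological_space) depletion_data"
  assumes finite_activities: "finite (activities Q)"
    and activities_nonempty: "activities Q \<noteq> {}"
    and horizon_pos: "0 < horizon Q"
    and compact_statistic_space: "compact (statistic_space Q)"
    and statistic_in: "A \<in> activities Q \<Longrightarrow> statistic Q t A \<in> statistic_space Q"
    and depletion_le: "\<lbrakk>x \<le> capacity Q; t < horizon Q; A \<in> activities Q\<rbrakk>
          \<Longrightarrow> set_pmf (depletion Q x (statistic Q t A)) \<subseteq> {\<alpha>. \<alpha> \<le> x}"
    and gain_nonneg: "t \<le> horizon Q \<Longrightarrow> 0 \<le> gain Q x x' t"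
    and gain_antimono: "\<lbrakk>t \<le> t'; t' \<le> horizon Q\<rbrakk> \<Longrightarrow> gain Q x x' t' \<le> gain Q x x' t"
    and gain_horizon: "gain Q x x' (horizon Q) = 0"

definition next_state :: "('m, 'a, 'r) depletion_data \<Rightarrow> 'm state \<Rightarrow> 'a \<Rightarrow> 'm state pmf" where
  "next_state Q s A =
     map_pmf (\<lambda>X. (fst s - X, Suc (snd s))) (depletion Q (fst s) (statistic Q (snd s) A))"

text \<open>The random reward of an activity used in \<open>s\<close> is \<open>reward Q s s'\<close>, where \<open>s'\<close> is the
  random successor state, whose inventory is what is left of that of \<open>s\<close>.\<close>

definition reward :: "('m, 'a, 'r) depletion_data \<Rightarrow> 'm state \<Rightarrow> 'm state \<Rightarrow> real" where
  "reward Q s s' = gain Q (fst s) (fst s') (snd s)"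

text \<open>At the horizon nothing is depleted any more; there the following value is 0 for every
  activity because \<^const>\<open>gain\<close> vanishes.\<close>

definition expected_reward :: "('m, 'a, 'r) depletion_data \<Rightarrow> 'm state \<Rightarrow> 'a \<Rightarrow> real" where
  "expected_reward Q s A = measure_pmf.expectation (next_state Q s A) (reward Q s)"

definition policies :: "('m, 'a, 'r) depletion_data \<Rightarrow> ('m state \<Rightarrow> 'a) set" where
  "policies Q = states Q \<rightarrow>\<^sub>E activities Q"

text \<open>Joint law of the state process under \<open>\<pi>\<close> started in \<open>s\<close>, after \<open>n\<close> transitions: under a
  sample \<open>S\<close>, the state at time \<open>t\<close> is \<open>S t\<close> for \<open>snd s \<le> t \<le> snd s + n\<close>; other values of \<open>S\<close>
  are meaningless.\<close>

primrec state_process ::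
  "('m, 'a, 'r) depletion_data \<Rightarrow> ('m state \<Rightarrow> 'a) \<Rightarrow> 'm state \<Rightarrow> nat \<Rightarrow> (nat \<Rightarrow> 'm state) pmf" where
  "state_process Q \<pi> s 0 = return_pmf (\<lambda>_. s)"
| "state_process Q \<pi> s (Suc n) =
     bind_pmf (state_process Q \<pi> s n) (\<lambda>S. let t = snd s + n in
       map_pmf (\<lambda>s'. S(Suc t := s')) (next_state Q (S t) (\<pi> (S t))))"

definition reward_to_go ::
  "('m, 'a, 'r) depletion_data \<Rightarrow> ('m state \<Rightarrow> 'a) \<Rightarrow> 'm state \<Rightarrow> real" where
  "reward_to_go Q \<pi> s =
     measure_pmf.expectation (state_process Q \<pi> s (horizon Q - snd s))
       (\<lambda>S. \<Sum>t = snd s..<horizon Q. reward Q (S t) (S (Suc t)))"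

definition optimal_value :: "('m, 'a, 'r) depletion_data \<Rightarrow> 'm state \<Rightarrow> real" where
  "optimal_value Q s = (MAX \<pi>\<in>policies Q. reward_to_go Q \<pi> s)"

definition myopic :: "('m, 'a, 'r) depletion_data \<Rightarrow> ('m state \<Rightarrow> 'a) \<Rightarrow> bool" where
  "myopic Q \<pi> \<longleftrightarrow> \<pi> \<in> policies Q \<and>
     (\<forall>s\<in>states Q. is_arg_max (expected_reward Q s) (\<lambda>A. A \<in> activities Q) (\<pi> s))"

definition remove_items :: "('m \<Rightarrow> nat) \<Rightarrow> 'm state \<Rightarrow> 'm state" where
  "remove_items \<alpha> s = (fst s - \<alpha>, snd s)"

definition value_function_monotonicity :: "('m, 'a, 'r) depletion_data \<Rightarrow> bool" where
  "value_function_monotonicity Q \<longleftrightarrow>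
     (\<forall>s\<in>states Q. \<forall>s'\<in>states Q. fst s' \<le> fst s \<and> snd s = snd s' \<longrightarrow>
        optimal_value Q s' \<le> optimal_value Q s)"

definition immediate_rewards :: "('m, 'a, 'r) depletion_data \<Rightarrow> bool" where
  "immediate_rewards Q \<longleftrightarrow>
     (\<forall>s\<in>states Q. \<forall>\<alpha>\<le>fst s.
        optimal_value Q s
          \<le> gain Q (fst s) (fst s - \<alpha>) (snd s) + optimal_value Q (remove_items \<alpha> s))"

end

theory Submission
  imports Defs
begin

text \<open>The bound follows by backward induction on time. Let \<open>s = (x, t)\<close> with \<open>t\<close> before the
  horizon, and let \<open>A\<close> be the activity that an optimal policy uses in \<open>s\<close>. Conditioning on the
  first transition, and bounding the value of every successor of \<open>s\<close> by monotonicity, gives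
  \<open>J\<^sup>*(x, t) \<le> E[R(s, A)] + J\<^sup>*(x, t + 1)\<close>, where \<open>E[R(s, A)]\<close> is at most the expected myopic
  reward in \<open>s\<close>.
  The immediate-rewards property at \<open>(x, t + 1)\<close>, applied to the vector \<open>\<alpha>\<close> that the myopic
  activity depletes, together with the monotonicity of the gain in time, gives
  \<open>J\<^sup>*(x, t + 1) \<le> g(x, x - \<alpha>, t) + J\<^sup>*(x - \<alpha>, t + 1)\<close>, which is averaged over \<open>\<alpha>\<close>.
  Hence \<open>J\<^sup>*(s)\<close> is at most twice the expected myopic reward in \<open>s\<close> plus the expectation of
  \<open>J\<^sup>*\<close> at the myopic successor, to which the induction hypothesis applies.

  What needs work is the first-step decomposition of the reward-to-go
  (\<open>reward_to_go_step\<close>), because the state process is built by appending transitions at its end.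
  It comes from expressing the reward-to-go as an iterate of the Bellman operator of the policy;
  iterates can be unfolded at either end. All laws involved have finite support, so
  integrability is never an issue.\<close>

section \<open>Expectations under laws of finite support\<close>

lemma expectation_pmf_add:
  fixes f g :: "_ \<Rightarrow> real"
  assumes "finite (set_pmf p)"
  shows "measure_pmf.expectation p (\<lambda>x. f x + g x) =
    measure_pmf.expectation p f + measure_pmf.expectation p g"
  by (intro Bochner_Integration.integral_add integrable_measure_pmf_finite assms)

lemma expectation_pmf_mono:
  fixes f g :: "_ \<Rightarrow> real"
  assumes "finite (set_pmf p)" and "\<And>x. x \<in> set_pmf p \<Longrightarrow> f x \<le> g x"
  shows "measure_pmf.expectation p f \<le> measure_pmf.expectation p g"
  using assms
  by (intro integral_mono_AE integrable_measure_pmf_finite) (auto simp: AE_measure_pmf_iff)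

lemma expectation_pmf_cong:
  fixes f g :: "_ \<Rightarrow> real"
  assumes "\<And>x. x \<in> set_pmf p \<Longrightarrow> f x = g x"
  shows "measure_pmf.expectation p f = measure_pmf.expectation p g"
  using assms by (intro integral_cong_AE) (auto simp: AE_measure_pmf_iff)

lemma expectation_bind_pmf_finite:
  fixes h :: "_ \<Rightarrow> real"
  assumes "finite (set_pmf p)" and "\<And>x. x \<in> set_pmf p \<Longrightarrow> finite (set_pmf (f x))"
  shows "measure_pmf.expectation (bind_pmf p f) h =
    measure_pmf.expectation p (\<lambda>x. measure_pmf.expectation (f x) h)"
  using pmf_expectation_bind[where h = h, OF assms(1,2) order_refl]
    integral_measure_pmf[OF assms(1), of p "\<lambda>x. measure_pmf.expectation (f x) h"]
  by simp

lemma finite_pointwise_le: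
  fixes x :: "'m::finite \<Rightarrow> nat"
  shows "finite {y. y \<le> x}"
proof -
  have "{y. y \<le> x} = (\<Pi>\<^sub>E m\<in>UNIV. {..x m})"
    by (auto simp: le_fun_def PiE_def Pi_def)
  then show ?thesis
    by (simp add: finite_PiE)
qed

section \<open>Reward-to-go as an iterate of the Bellman operator\<close>

text \<open>The Bellman operator of a policy: the expected reward of one transition under \<open>\<pi>\<close> plus the
  expectation of the continuation value \<open>f\<close>.\<close>

definition policy_bellman ::
  "('m, 'a, 'r) depletion_data \<Rightarrow> ('m state \<Rightarrow> 'a) \<Rightarrow> ('m state \<Rightarrow> real) \<Rightarrow> 'm state \<Rightarrow> real" where
  "policy_bellman Q \<pi> f s =
     measure_pmf.expectation (next_state Q s (\<pi> s)) (\<lambda>s'. reward Q s s' + f s')"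

context stochastic_depletion_problem
begin

lemma finite_policies: "finite (policies Q)"
  unfolding policies_def states_def
  by (intro finite_PiE finite_cartesian_product finite_pointwise_le finite_atMost finite_activities)

lemma policies_nonempty: "policies Q \<noteq> {}"
  unfolding policies_def using activities_nonempty by (simp add: PiE_eq_empty_iff)

lemma policy_activity: "\<lbrakk>\<pi> \<in> policies Q; s \<in> states Q\<rbrakk> \<Longrightarrow> \<pi> s \<in> activities Q"
  unfolding policies_def by auto

lemma next_state_support:
  assumes "s \<in> states Q" "snd s < horizon Q" "A \<in> activities Q" "s' \<in> set_pmf (next_state Q s A)"
  obtains \<alpha> where "\<alpha> \<le> fst s" "s' = (fst s - \<alpha>, Suc (snd s))" "s' \<in> states Q"
proof -
  have x: "fst s \<le> capacity Q"
    using assms(1) by (auto simp: states_def)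
  obtain \<alpha> where \<alpha>: "\<alpha> \<le> fst s" "s' = (fst s - \<alpha>, Suc (snd s))"
    using assms(4) depletion_le[OF x assms(2,3)] by (auto simp: next_state_def)
  have "fst s - \<alpha> \<le> fst s"
    by (simp add: le_fun_def)
  then have "fst s - \<alpha> \<le> capacity Q"
    using x by (rule order_trans)
  then have "s' \<in> states Q"
    using assms(2) \<alpha>(2) by (simp add: states_def)
  with \<alpha> show thesis by (rule that)
qed

lemma finite_next_state:
  assumes "s \<in> states Q" "snd s < horizon Q" "A \<in> activities Q"
  shows "finite (set_pmf (next_state Q s A))"
proof -
  have "fst s \<le> capacity Q"
    using assms(1) by (auto simp: states_def)
  then have "finite (set_pmf (depletion Q (fst s) (statistic Q (snd s) A)))"
    using depletion_le[of "fst s"] assms(2,3) finite_subset[OF _ finite_pointwise_le] by blast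
  then show ?thesis
    by (simp add: next_state_def)
qed

lemma state_process_support:
  assumes "\<pi> \<in> policies Q" "s \<in> states Q" "snd s + n \<le> horizon Q"
  shows "finite (set_pmf (state_process Q \<pi> s n)) \<and>
    (\<forall>S\<in>set_pmf (state_process Q \<pi> s n).
       S (snd s + n) \<in> states Q \<and> snd (S (snd s + n)) = snd s + n)"
  using assms(3)
proof (induction n)
  case 0
  then show ?case using assms by simp
next
  case (Suc n)
  then have IH: "finite (set_pmf (state_process Q \<pi> s n))"
    "\<And>S. S \<in> set_pmf (state_process Q \<pi> s n) \<Longrightarrow>
       S (snd s + n) \<in> states Q \<and> snd (S (snd s + n)) = snd s + n"
    by auto
  have lt: "snd s + n < horizon Q"
    using Suc.prems by simp
  have step: "finite (set_pmf (next_state Q (S (snd s + n)) (\<pi> (S (snd s + n)))))"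
    "\<And>s'. s' \<in> set_pmf (next_state Q (S (snd s + n)) (\<pi> (S (snd s + n)))) \<Longrightarrow>
       s' \<in> states Q \<and> snd s' = Suc (snd s + n)"
    if S: "S \<in> set_pmf (state_process Q \<pi> s n)" for S
  proof -
    have *: "S (snd s + n) \<in> states Q" "snd (S (snd s + n)) < horizon Q"
      "\<pi> (S (snd s + n)) \<in> activities Q"
      using IH(2)[OF S] lt policy_activity[OF assms(1)] by auto
    show "finite (set_pmf (next_state Q (S (snd s + n)) (\<pi> (S (snd s + n)))))"
      by (rule finite_next_state[OF *])
    show "s' \<in> states Q \<and> snd s' = Suc (snd s + n)"
      if "s' \<in> set_pmf (next_state Q (S (snd s + n)) (\<pi> (S (snd s + n))))" for s'
      by (rule next_state_support[OF * that]) (simp add: IH(2)[OF S])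
  qed
  have "finite (set_pmf (state_process Q \<pi> s (Suc n)))"
    using IH(1) step(1) by (simp add: Let_def)
  moreover have "S (snd s + Suc n) \<in> states Q \<and> snd (S (snd s + Suc n)) = snd s + Suc n"
    if S: "S \<in> set_pmf (state_process Q \<pi> s (Suc n))" for S
  proof -
    obtain S' s' where S': "S' \<in> set_pmf (state_process Q \<pi> s n)"
      and s': "s' \<in> set_pmf (next_state Q (S' (snd s + n)) (\<pi> (S' (snd s + n))))"
      and "S = S'(Suc (snd s + n) := s')"
      using S unfolding state_process.simps Let_def set_bind_pmf set_map_pmf by blast
    then show ?thesis
      using step(2)[OF S' s'] by simp
  qed
  ultimately show ?case by blast
qed

text \<open>The continuation value \<open>f\<close> is arbitrary because the induction replaces it by its image under
  the Bellman operator: the transition appended last turns into a new continuation value.\<close>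

lemma expectation_state_process:
  assumes "\<pi> \<in> policies Q" "s \<in> states Q" "snd s + n \<le> horizon Q"
  shows "measure_pmf.expectation (state_process Q \<pi> s n)
      (\<lambda>S. (\<Sum>t = snd s..<snd s + n. reward Q (S t) (S (Suc t))) + f (S (snd s + n))) =
    (policy_bellman Q \<pi> ^^ n) f s"
  using assms(3)
proof (induction n arbitrary: f)
  case 0
  then show ?case by simp
next
  case (Suc n)
  let ?P = "state_process Q \<pi> s n" and ?t = "snd s + n"
  let ?N = "\<lambda>S. next_state Q (S ?t) (\<pi> (S ?t))"
  let ?r = "\<lambda>S. \<Sum>t = snd s..<?t. reward Q (S t) (S (Suc t))"
  have supp: "finite (set_pmf ?P)"
    "\<And>S. S \<in> set_pmf ?P \<Longrightarrow> S ?t \<in> states Q \<and> snd (S ?t) = ?t"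
    using state_process_support[OF assms(1,2), of n] Suc.prems by auto
  have fin: "finite (set_pmf (?N S))" if "S \<in> set_pmf ?P" for S
    using supp(2)[OF that] Suc.prems policy_activity[OF assms(1)]
    by (intro finite_next_state) auto
  have sum_upd: "(\<Sum>t = snd s..<Suc ?t.
        reward Q ((S(Suc ?t := s')) t) ((S(Suc ?t := s')) (Suc t))) =
      ?r S + reward Q (S ?t) s'" for S s'
    by (simp add: sum.atLeastLessThan_Suc)
  have "measure_pmf.expectation (state_process Q \<pi> s (Suc n))
      (\<lambda>S. (\<Sum>t = snd s..<snd s + Suc n. reward Q (S t) (S (Suc t))) + f (S (snd s + Suc n))) =
    measure_pmf.expectation ?P (\<lambda>S. measure_pmf.expectation (?N S)
      (\<lambda>s'. ?r S + (reward Q (S ?t) s' + f s')))"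
    unfolding state_process.simps Let_def
    by (simp only: expectation_bind_pmf_finite[OF supp(1)] fin set_map_pmf finite_imageI
        integral_map_pmf sum_upd add_Suc_right fun_upd_same add.assoc)
  also have "\<dots> = measure_pmf.expectation ?P (\<lambda>S. ?r S + policy_bellman Q \<pi> f (S ?t))"
  proof (rule expectation_pmf_cong)
    fix S assume "S \<in> set_pmf ?P"
    then show "measure_pmf.expectation (?N S) (\<lambda>s'. ?r S + (reward Q (S ?t) s' + f s')) =
        ?r S + policy_bellman Q \<pi> f (S ?t)"
      unfolding policy_bellman_def by (subst expectation_pmf_add) (simp_all add: fin)
  qed
  also have "\<dots> = (policy_bellman Q \<pi> ^^ n) (policy_bellman Q \<pi> f) s"
    using Suc by simp
  also have "\<dots> = (policy_bellman Q \<pi> ^^ Suc n) f s"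
    by (simp add: funpow_Suc_right del: funpow.simps)
  finally show ?case .
qed

lemma reward_to_go_eq_bellman:
  assumes "\<pi> \<in> policies Q" "s \<in> states Q"
  shows "reward_to_go Q \<pi> s = (policy_bellman Q \<pi> ^^ (horizon Q - snd s)) (\<lambda>_. 0) s"
proof -
  have "snd s \<le> horizon Q"
    using assms(2) by (auto simp: states_def)
  then show ?thesis
    using expectation_state_process[OF assms, of "horizon Q - snd s" "\<lambda>_. 0"]
    by (simp add: reward_to_go_def)
qed

lemma reward_to_go_step:
  assumes "\<pi> \<in> policies Q" "s \<in> states Q" "snd s < horizon Q"
  shows "reward_to_go Q \<pi> s = expected_reward Q s (\<pi> s) +
    measure_pmf.expectation (next_state Q s (\<pi> s)) (reward_to_go Q \<pi>)"
proof -
  let ?N = "next_state Q s (\<pi> s)" and ?n = "horizon Q - Suc (snd s)"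
  have act: "\<pi> s \<in> activities Q"
    using policy_activity assms by blast
  have n: "horizon Q - snd s = Suc ?n"
    using assms(3) by simp
  have succ: "(policy_bellman Q \<pi> ^^ ?n) (\<lambda>_. 0) s' = reward_to_go Q \<pi> s'"
    if s': "s' \<in> set_pmf ?N" for s'
  proof -
    have "s' \<in> states Q" "snd s' = Suc (snd s)"
      by (rule next_state_support[OF assms(2,3) act s'], simp)+
    then show ?thesis
      using reward_to_go_eq_bellman[OF assms(1), of s'] by simp
  qed
  have "reward_to_go Q \<pi> s = policy_bellman Q \<pi> ((policy_bellman Q \<pi> ^^ ?n) (\<lambda>_. 0)) s"
    unfolding reward_to_go_eq_bellman[OF assms(1,2)] n by simp
  also have "\<dots> = measure_pmf.expectation ?N (\<lambda>s'. reward Q s s' + reward_to_go Q \<pi> s')"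
    unfolding policy_bellman_def[of Q \<pi> _ s] by (rule expectation_pmf_cong) (simp add: succ)
  also have "\<dots> = expected_reward Q s (\<pi> s) + measure_pmf.expectation ?N (reward_to_go Q \<pi>)"
    by (simp add: expectation_pmf_add finite_next_state[OF assms(2,3) act] expected_reward_def)
  finally show ?thesis .
qed

section \<open>The optimal value and the myopic policy\<close>

lemma reward_to_go_le_optimal_value:
  "\<pi> \<in> policies Q \<Longrightarrow> reward_to_go Q \<pi> s \<le> optimal_value Q s"
  unfolding optimal_value_def by (simp add: finite_policies)

lemma optimal_value_attained:
  obtains \<pi> where "\<pi> \<in> policies Q" "optimal_value Q s = reward_to_go Q \<pi> s"
proof -
  have "optimal_value Q s \<in> (\<lambda>\<pi>. reward_to_go Q \<pi> s) ` policies Q"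
    unfolding optimal_value_def by (intro Max_in) (simp_all add: finite_policies policies_nonempty)
  then show thesis using that by blast
qed

lemma optimal_value_horizon:
  assumes "snd s = horizon Q"
  shows "optimal_value Q s = 0"
  by (rule optimal_value_attained[of s]) (use assms in \<open>simp add: reward_to_go_def\<close>)

text \<open>Skipping a period while keeping the whole inventory lowers the optimal value by at most the
  expected myopic reward of that period.\<close>

lemma optimal_value_le_myopic_plus_wait:
  assumes "myopic Q \<pi>g" "value_function_monotonicity Q" "s \<in> states Q" "snd s < horizon Q"
  shows "optimal_value Q s \<le>
    expected_reward Q s (\<pi>g s) + optimal_value Q (fst s, Suc (snd s))"
proof -
  let ?w = "(fst s, Suc (snd s))"
  obtain \<pi> where \<pi>: "\<pi> \<in> policies Q" "optimal_value Q s = reward_to_go Q \<pi> s"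
    by (rule optimal_value_attained)
  let ?N = "next_state Q s (\<pi> s)"
  have act: "\<pi> s \<in> activities Q"
    using policy_activity \<pi>(1) assms(3) by blast
  have w: "?w \<in> states Q"
    using assms(3,4) by (auto simp: states_def)
  have bound: "reward_to_go Q \<pi> s' \<le> optimal_value Q ?w" if s': "s' \<in> set_pmf ?N" for s'
  proof -
    obtain \<alpha> where "\<alpha> \<le> fst s" "s' = (fst s - \<alpha>, Suc (snd s))" "s' \<in> states Q"
      by (rule next_state_support[OF assms(3,4) act s'])
    moreover have "fst s - \<alpha> \<le> fst s"
      by (auto simp: le_fun_def)
    ultimately have "optimal_value Q s' \<le> optimal_value Q ?w"
      using assms(2) w unfolding value_function_monotonicity_def by auto
    then show ?thesis
      using reward_to_go_le_optimal_value[OF \<pi>(1), of s'] by linarith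
  qed
  have "measure_pmf.expectation ?N (reward_to_go Q \<pi>) \<le>
      measure_pmf.expectation ?N (\<lambda>_. optimal_value Q ?w)"
    by (rule expectation_pmf_mono[OF finite_next_state[OF assms(3,4) act] bound])
  moreover have "expected_reward Q s (\<pi> s) \<le> expected_reward Q s (\<pi>g s)"
    using assms(1,3) act by (auto simp: myopic_def is_arg_max_linorder)
  ultimately show ?thesis
    using reward_to_go_step[OF \<pi>(1) assms(3,4)] \<pi>(2) by simp
qed

text \<open>Immediate rewards are used at the state reached by waiting, whose time is one later than that of
  \<open>s\<close>; the gain is non-increasing in time, so the reward at the time of \<open>s\<close> dominates.\<close>

lemma optimal_value_wait_le:
  assumes "immediate_rewards Q" "s \<in> states Q" "snd s < horizon Q" "A \<in> activities Q"
  shows "optimal_value Q (fst s, Suc (snd s)) \<le>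
    expected_reward Q s A + measure_pmf.expectation (next_state Q s A) (optimal_value Q)"
proof -
  let ?w = "(fst s, Suc (snd s))" and ?N = "next_state Q s A"
  have w: "?w \<in> states Q"
    using assms(2,3) by (auto simp: states_def)
  have fin: "finite (set_pmf ?N)"
    by (rule finite_next_state[OF assms(2-4)])
  have bound: "optimal_value Q ?w \<le> reward Q s s' + optimal_value Q s'"
    if s': "s' \<in> set_pmf ?N" for s'
  proof -
    obtain \<alpha> where \<alpha>: "\<alpha> \<le> fst s" "s' = (fst s - \<alpha>, Suc (snd s))" "s' \<in> states Q"
      by (rule next_state_support[OF assms(2-4) s'])
    have "optimal_value Q ?w \<le> gain Q (fst s) (fst s - \<alpha>) (Suc (snd s)) + optimal_value Q s'"
      using assms(1) w \<alpha> unfolding immediate_rewards_def remove_items_def by fastforce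
    moreover have "gain Q (fst s) (fst s - \<alpha>) (Suc (snd s)) \<le> reward Q s s'"
      unfolding reward_def using \<alpha>(2) assms(3) by (auto intro: gain_antimono)
    ultimately show ?thesis by linarith
  qed
  have "optimal_value Q ?w = measure_pmf.expectation ?N (\<lambda>_. optimal_value Q ?w)"
    by simp
  also have "\<dots> \<le> measure_pmf.expectation ?N (\<lambda>s'. reward Q s s' + optimal_value Q s')"
    by (rule expectation_pmf_mono[OF fin bound])
  also have "\<dots> = expected_reward Q s A + measure_pmf.expectation ?N (optimal_value Q)"
    by (simp add: expectation_pmf_add[OF fin] expected_reward_def)
  finally show ?thesis .
qed

lemma optimal_value_le_twice_myopic:
  assumes "myopic Q \<pi>g" "value_function_monotonicity Q" "immediate_rewards Q" "s \<in> states Q"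
  shows "optimal_value Q s \<le> 2 * reward_to_go Q \<pi>g s"
  using assms(4)
proof (induction "horizon Q - snd s" arbitrary: s)
  case 0
  then have "snd s = horizon Q"
    by (auto simp: states_def)
  then show ?case
    by (simp add: optimal_value_horizon reward_to_go_def)
next
  case (Suc n)
  then have lt: "snd s < horizon Q"
    by simp
  have pol: "\<pi>g \<in> policies Q"
    using assms(1) by (simp add: myopic_def)
  have act: "\<pi>g s \<in> activities Q"
    using policy_activity[OF pol Suc.prems] .
  let ?N = "next_state Q s (\<pi>g s)"
  have IH: "optimal_value Q s' \<le> 2 * reward_to_go Q \<pi>g s'" if s': "s' \<in> set_pmf ?N" for s'
  proof -
    have "s' \<in> states Q" "snd s' = Suc (snd s)"
      by (rule next_state_support[OF Suc.prems lt act s'], simp)+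
    then show ?thesis
      using Suc.hyps by (intro Suc.hyps(1)) auto
  qed
  have "measure_pmf.expectation ?N (optimal_value Q) \<le>
      measure_pmf.expectation ?N (\<lambda>s'. 2 * reward_to_go Q \<pi>g s')"
    by (rule expectation_pmf_mono[OF finite_next_state[OF Suc.prems lt act] IH])
  then have "measure_pmf.expectation ?N (optimal_value Q) \<le>
      2 * measure_pmf.expectation ?N (reward_to_go Q \<pi>g)"
    by simp
  then show ?case
    using optimal_value_le_myopic_plus_wait[OF assms(1,2) Suc.prems lt]
      optimal_value_wait_le[OF assms(3) Suc.prems lt act]
      reward_to_go_step[OF pol Suc.prems lt]
    by simp
qed

end

theorem theorem2:
  fixes Q :: "('m::finite, 'a, 'r::topological_space) depletion_data"
    and \<pi>g :: "'m state \<Rightarrow> 'a"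
  assumes "stochastic_depletion_problem Q"
    and "myopic Q \<pi>g"
    and "value_function_monotonicity Q"
    and "immediate_rewards Q"
  shows "\<forall>s\<in>states Q. optimal_value Q s \<le> 2 * reward_to_go Q \<pi>g s"
  using stochastic_depletion_problem.optimal_value_le_twice_myopic[OF assms] by blast

end
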